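(* Let $r$ be a fixed positive integer, let $p=p(n)$ satisfy $p \gg \sqrt{\log n/n}$, and let $G=\mathbb{G}(n,p)$. Then with high probability \[ \kappa_{r,2}(G) \sim \left(1-\frac{1}{r}\right) np^2 . \]
   Context: $\mathbb{G}(n,p)$ is the random graph on $n$ vertices in which each pair of vertices is an edge independently with probability $p$. A path is alternating (with respect to an edge-coloring) if no two consecutive edges of the path have the same color; the length of a path is its number of edges. For a graph $G$, $\kappa_{r,\ell}(G)$ is the maximum $t$ such that there is an $r$-edge-coloring of $G$ in which every pair of distinct vertices is connected by $t$ internally vertex-disjoint alternating paths of length $\ell$. All asymptotics are as $n\to\infty$; $f\sim g$ means $f=(1+o(1))g$; $f\gg g$ means $g=o(f)$; "with high probability" means with probability tending to $1$ as $n\to\infty$. *)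

theory Defs
  imports "HOL-Probability.Probability" "HOL-Library.Landau_Symbols"
begin

text \<open>
  A finite simple graph is given by its vertex set \<open>V\<close> and its edge set \<open>E\<close>, a set of
  two-element subsets of \<open>V\<close>.
\<close>

definition all_pairs :: "'a set \<Rightarrow> 'a set set" where
  "all_pairs V = {e. e \<subseteq> V \<and> card e = 2}"

text \<open>
  The random graph on the vertices \<open>0, \<dots>, n - 1\<close>, as the distribution of its edge set.
\<close>

definition Gnp :: "nat \<Rightarrow> real \<Rightarrow> nat set set pmf" where
  "Gnp n p = map_pmf (\<lambda>f. {e \<in> all_pairs {..<n}. f e})
     (Pi_pmf (all_pairs {..<n}) False (\<lambda>_. bernoulli_pmf p))"

text \<open>
  Paths are lists of distinct vertices, so a path of length \<open>l\<close> (with \<open>l\<close> edges) has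
  \<open>Suc l\<close> entries.
\<close>

definition is_path :: "'a set \<Rightarrow> 'a set set \<Rightarrow> nat \<Rightarrow> 'a \<Rightarrow> 'a \<Rightarrow> 'a list \<Rightarrow> bool" where
  "is_path V E l u v xs \<longleftrightarrow>
     length xs = Suc l \<and> set xs \<subseteq> V \<and> distinct xs \<and> hd xs = u \<and> last xs = v \<and>
     (\<forall>i. Suc i < length xs \<longrightarrow> {xs ! i, xs ! Suc i} \<in> E)"

definition alternating :: "('a set \<Rightarrow> nat) \<Rightarrow> 'a list \<Rightarrow> bool" where
  "alternating c xs \<longleftrightarrow>
     (\<forall>i. Suc (Suc i) < length xs \<longrightarrow>
        c {xs ! i, xs ! Suc i} \<noteq> c {xs ! Suc i, xs ! Suc (Suc i)})"

definition internal_vertices :: "'a list \<Rightarrow> 'a set" where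
  "internal_vertices xs = set (butlast (tl xs))"

definition alt_connected ::
  "'a set \<Rightarrow> 'a set set \<Rightarrow> ('a set \<Rightarrow> nat) \<Rightarrow> nat \<Rightarrow> nat \<Rightarrow> 'a \<Rightarrow> 'a \<Rightarrow> bool" where
  "alt_connected V E c l t u v \<longleftrightarrow>
     (\<exists>P. finite P \<and> card P = t \<and>
        (\<forall>xs\<in>P. is_path V E l u v xs \<and> alternating c xs) \<and>
        disjoint_family_on internal_vertices P)"

text \<open>
  An edge colouring need not be proper; its values outside \<open>E\<close> play no role.
\<close>

definition edge_coloring :: "nat \<Rightarrow> 'a set set \<Rightarrow> ('a set \<Rightarrow> nat) \<Rightarrow> bool" where
  "edge_coloring r E c \<longleftrightarrow> c ` E \<subseteq> {..<r}"

text \<open>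
  For finite \<open>V\<close> with at least two vertices and \<open>r > 0\<close> the set below is finite and contains
  \<open>0\<close>, so the maximum exists. If \<open>V\<close> has at most one vertex then every \<open>t\<close> qualifies and
  the value is unspecified, which is irrelevant for asymptotic statements.
\<close>

definition kappa :: "nat \<Rightarrow> nat \<Rightarrow> 'a set \<Rightarrow> 'a set set \<Rightarrow> nat" where
  "kappa r l V E = Max {t. \<exists>c. edge_coloring r E c \<and>
     (\<forall>u\<in>V. \<forall>v\<in>V. u \<noteq> v \<longrightarrow> alt_connected V E c l t u v)}"

text \<open>
  \<open>X n \<sim> g n\<close> with high probability, that is \<open>X n = (1 + o(1)) g n\<close> with high probability,
  for a sequence of random variables \<open>X n\<close> on the probability spaces \<open>M n\<close> and a
  deterministic sequence \<open>g\<close>. The inequality is not strict, so that where \<open>g n = 0\<close> it says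
  \<open>X n = 0\<close>, as \<open>X n = (1 + o(1)) g n\<close> demands.
\<close>

definition whp_asymp_equiv ::
  "(nat \<Rightarrow> 'a pmf) \<Rightarrow> (nat \<Rightarrow> 'a \<Rightarrow> real) \<Rightarrow> (nat \<Rightarrow> real) \<Rightarrow> bool" where
  "whp_asymp_equiv M X g \<longleftrightarrow>
     (\<forall>\<epsilon>>0. (\<lambda>n. measure_pmf.prob (M n) {\<omega>. \<bar>X n \<omega> - g n\<bar> \<le> \<epsilon> * \<bar>g n\<bar>})
        \<longlonglongrightarrow> 1)"

end

theory Submission imports Defs "HOL-Real_Asymp.Real_Asymp" begin

text \<open>
  Alternating paths of length \<open>2\<close> between \<open>u\<close> and \<open>v\<close> correspond to common neighbours \<open>w\<close>
  with \<open>uw\<close> and \<open>wv\<close> of different colours, and distinct ones are internally disjoint. Since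
  \<open>n p\<^sup>2\<close> grows faster than \<open>ln n\<close>, a Chernoff bound and a union bound show that with high
  probability every codegree is \<open>(1 + o(1)) n p\<^sup>2\<close>; the rest of the argument is about a fixed
  such graph. Upper bound: at each vertex at most a fraction \<open>1 - 1/r\<close> of the ordered pairs of
  incident edges is bichromatic by Cauchy--Schwarz, and the number of these pairs over all vertices
  is the sum of all codegrees and degrees, so some pair \<open>u \<noteq> v\<close> has at most about
  \<open>(1 - 1/r) n p\<^sup>2\<close> alternating paths. Lower bound: in a uniformly random colouring each common
  neighbour is good with probability \<open>1 - 1/r\<close>, independently, and Chernoff applies again.
\<close>

section \<open>Independence and concentration for counts of pairs\<close>

text \<open>Coordinates not hit by \<open>b\<close> get the constant factor 1; padding the product
  in this way reduces the claim to the product formula over all of \<open>A\<close>.\<close>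

lemma nn_integral_prod_Pi_pmf_inj_on:
  assumes "finite A" and "inj_on b W" and "b ` W \<subseteq> A"
  shows "(\<integral>\<^sup>+h. (\<Prod>w\<in>W. G w (h (b w))) \<partial>Pi_pmf A dflt q) = (\<Prod>w\<in>W. \<integral>\<^sup>+y. G w y \<partial>q (b w))"
proof -
  define H where "H e = (if e \<in> b ` W then G (inv_into W b e) else (\<lambda>_. 1))" for e
  have H: "(\<Prod>e\<in>A. F e) = (\<Prod>w\<in>W. F (b w))" if "\<And>e. e \<in> A - b ` W \<Longrightarrow> F e = 1" for F :: "_ \<Rightarrow> ennreal"
  proof -
    have "(\<Prod>e\<in>A. F e) = (\<Prod>e\<in>b ` W. F e)"
      using assms that by (intro prod.mono_neutral_right) auto
    then show ?thesis
      using assms by (simp add: prod.reindex)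
  qed
  have "(\<Prod>w\<in>W. G w (h (b w))) = (\<Prod>e\<in>A. H e (h e))" for h
    using assms by (subst H) (auto simp: H_def intro!: prod.cong)
  then have "(\<integral>\<^sup>+h. (\<Prod>w\<in>W. G w (h (b w))) \<partial>Pi_pmf A dflt q) = (\<Prod>e\<in>A. \<integral>\<^sup>+y. H e y \<partial>q e)"
    using assms by (simp add: nn_integral_prod_Pi_pmf)
  also have "\<dots> = (\<Prod>w\<in>W. \<integral>\<^sup>+y. G w y \<partial>q (b w))"
    using assms by (subst H) (auto simp: H_def intro!: prod.cong)
  finally show ?thesis .
qed

text \<open>The \<open>2 * card W\<close> coordinates that are read are distinct, so the factors are
  independent. The coordinates in the image of \<open>a\<close> are split off as an independent
  function; integrating first over the others and then over these factorises the product
  twice.\<close>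

lemma nn_integral_prod_pairs_Pi_pmf:
  assumes A: "finite A" and W: "finite W"
    and a: "inj_on a W" "a ` W \<subseteq> A" and b: "inj_on b W" "b ` W \<subseteq> A"
    and disj: "a ` W \<inter> b ` W = {}"
  shows "(\<integral>\<^sup>+f. (\<Prod>w\<in>W. g (f (a w)) (f (b w))) \<partial>Pi_pmf A dflt (\<lambda>_. q)) =
    (\<integral>\<^sup>+z. g (fst z) (snd z) \<partial>pair_pmf q q) ^ card W"
proof -
  let ?A1 = "a ` W" and ?A2 = "A - a ` W"
  have fin: "finite ?A1" "finite ?A2"
    using A W by auto
  have "Pi_pmf A dflt (\<lambda>_. q) = Pi_pmf (?A1 \<union> ?A2) dflt (\<lambda>_. q)"
    using a by (intro Pi_pmf_cong) auto
  also have "\<dots> = map_pmf (\<lambda>(f, h) x. if x \<in> ?A1 then f x else h x)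
      (pair_pmf (Pi_pmf ?A1 dflt (\<lambda>_. q)) (Pi_pmf ?A2 dflt (\<lambda>_. q)))"
    using fin by (intro Pi_pmf_union) auto
  finally have eq: "Pi_pmf A dflt (\<lambda>_. q) = \<dots>" .
  have b_notin: "b w \<noteq> a w'" if "w \<in> W" "w' \<in> W" for w w'
    using disj that by blast
  have "(\<integral>\<^sup>+f. (\<Prod>w\<in>W. g (f (a w)) (f (b w))) \<partial>Pi_pmf A dflt (\<lambda>_. q)) =
    (\<integral>\<^sup>+f. \<integral>\<^sup>+h. (\<Prod>w\<in>W. g (f (a w)) (h (b w))) \<partial>Pi_pmf ?A2 dflt (\<lambda>_. q) \<partial>Pi_pmf ?A1 dflt (\<lambda>_. q))"
    unfolding eq using b_notin
    by (auto simp: nn_integral_pair_pmf' case_prod_beta intro!: nn_integral_cong prod.cong)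
  also have "\<dots> = (\<integral>\<^sup>+f. (\<Prod>w\<in>W. \<integral>\<^sup>+y. g (f (a w)) y \<partial>q) \<partial>Pi_pmf ?A1 dflt (\<lambda>_. q))"
    using b disj fin by (intro nn_integral_cong nn_integral_prod_Pi_pmf_inj_on) auto
  also have "\<dots> = (\<Prod>w\<in>W. \<integral>\<^sup>+x. \<integral>\<^sup>+y. g x y \<partial>q \<partial>q)"
    using a fin by (subst nn_integral_prod_Pi_pmf_inj_on) auto
  finally show ?thesis
    by (simp add: nn_integral_pair_pmf')
qed

text \<open>For negative \<open>s\<close>, multiply \<open>1 + s + s^2\<close> by the quadratic
  Taylor lower bound for \<open>exp (- s)\<close>: the linear terms cancel and what remains beyond 1
  is nonnegative.\<close>

lemma exp_quadratic_bound:
  fixes s :: real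
  assumes "\<bar>s\<bar> \<le> 1 / 2"
  shows "exp s \<le> 1 + s + s\<^sup>2"
proof (cases "s \<ge> 0")
  case True
  with assms show ?thesis by (intro exp_bound) auto
next
  case False
  have "1 - s + s\<^sup>2 / 2 \<le> exp (- s)"
    using exp_lower_Taylor_quadratic[of "- s"] False by simp
  moreover have nonneg: "0 \<le> 1 + s + s\<^sup>2"
    using assms by (intro add_nonneg_nonneg[of "1 + s"]) auto
  ultimately have "(1 + s + s\<^sup>2) * (1 - s + s\<^sup>2 / 2) \<le> (1 + s + s\<^sup>2) * exp (- s)"
    by (intro mult_left_mono)
  moreover have "(1 + s + s\<^sup>2) * (1 - s + s\<^sup>2 / 2) = 1 + s\<^sup>2 * ((1 - s + s\<^sup>2) / 2)"
    by (simp add: field_simps power2_eq_square)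
  moreover have "0 \<le> s\<^sup>2 * ((1 - s + s\<^sup>2) / 2)"
    using False by (intro mult_nonneg_nonneg) auto
  ultimately have "1 \<le> (1 + s + s\<^sup>2) * exp (- s)"
    by linarith
  then show ?thesis
    by (simp add: exp_minus pos_le_divide_eq divide_inverse[symmetric])
qed

text \<open>The hypothesis is satisfied by every sum of independent indicators with mean \<open>\<mu>\<close>.\<close>

lemma chernoff_two_sided:
  fixes M :: "'a pmf" and X :: "'a \<Rightarrow> real"
  assumes \<mu>: "0 \<le> \<mu>" and \<delta>: "0 \<le> \<delta>" "\<delta> \<le> 1"
    and mgf: "\<And>s. (\<integral>\<^sup>+\<omega>. ennreal (exp (s * X \<omega>)) \<partial>M) \<le> ennreal (exp (\<mu> * (exp s - 1)))"
  shows "measure_pmf.prob M {\<omega>. \<not> \<bar>X \<omega> - \<mu>\<bar> \<le> \<delta> * \<mu>} \<le> 2 * exp (- (\<delta>\<^sup>2 * \<mu> / 4))"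
proof (cases "\<delta> = 0")
  \<comment> \<open>Here the right-hand side is 2, so any probability satisfies the bound.\<close>
  case True
  then show ?thesis
    by (auto intro: order_trans[OF measure_pmf.prob_le_1])
next
  case False
  \<comment> \<open>This \<open>s\<close> minimises the exponent
    \<open>\<mu> * (s\<^sup>2 - s * \<delta>)\<close> left by the quadratic bound for
    \<open>exp\<close>; \<open>\<delta> \<le> 1\<close> keeps it in the range of that bound.\<close>
  define s where "s = \<delta> / 2"
  have s: "0 < s" "s \<le> 1 / 2" "\<delta> = 2 * s"
    using False \<delta> by (auto simp: s_def)
  \<comment> \<open>The sign \<open>\<sigma>\<close> treats both tails at once: 1 gives the upper
    tail, -1 the lower tail.\<close>
  have tail: "measure_pmf.prob M {\<omega>. \<sigma> * \<mu> + \<delta> * \<mu> \<le> \<sigma> * X \<omega>} \<le> exp (- (\<delta>\<^sup>2 * \<mu> / 4))"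
    if \<sigma>: "\<sigma> = 1 \<or> \<sigma> = - 1" for \<sigma>
  proof -
    let ?a = "\<sigma> * \<mu> + \<delta> * \<mu>"
    have "emeasure M {\<omega> \<in> UNIV. ?a \<le> \<sigma> * X \<omega>} \<le>
        ennreal (exp (- s * ?a)) * (\<integral>\<^sup>+\<omega>. ennreal (exp (s * (\<sigma> * X \<omega>))) * indicator UNIV \<omega> \<partial>M)"
      using s by (intro Chernoff_ineq_nn_integral_ge) auto
    also have "\<dots> \<le> ennreal (exp (- s * ?a)) * ennreal (exp (\<mu> * (exp (s * \<sigma>) - 1)))"
      using mgf[of "s * \<sigma>"] by (intro mult_left_mono) (auto simp: mult.assoc)
    also have "\<dots> = ennreal (exp (- s * ?a + \<mu> * (exp (s * \<sigma>) - 1)))"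
      by (simp only: exp_add ennreal_mult exp_ge_zero)
    also have "\<dots> \<le> ennreal (exp (- (\<delta>\<^sup>2 * \<mu> / 4)))"
    proof -
      have "\<mu> * (exp (s * \<sigma>) - 1) \<le> \<mu> * (s * \<sigma> + (s * \<sigma>)\<^sup>2)"
        using exp_quadratic_bound[of "s * \<sigma>"] s \<sigma> \<mu> by (intro mult_left_mono) auto
      also have "(s * \<sigma>)\<^sup>2 = s\<^sup>2"
        using \<sigma> by auto
      finally show ?thesis
        by (intro ennreal_leI) (simp add: s(3) algebra_simps power2_eq_square)
    qed
    finally show ?thesis
      by (simp add: measure_pmf.emeasure_eq_measure)
  qed
  have "{\<omega>. \<not> \<bar>X \<omega> - \<mu>\<bar> \<le> \<delta> * \<mu>} \<subseteq>
      {\<omega>. 1 * \<mu> + \<delta> * \<mu> \<le> 1 * X \<omega>} \<union> {\<omega>. - 1 * \<mu> + \<delta> * \<mu> \<le> - 1 * X \<omega>}"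
    by (auto simp: abs_le_iff)
  then have "measure_pmf.prob M {\<omega>. \<not> \<bar>X \<omega> - \<mu>\<bar> \<le> \<delta> * \<mu>} \<le>
      measure_pmf.prob M {\<omega>. 1 * \<mu> + \<delta> * \<mu> \<le> 1 * X \<omega>} +
      measure_pmf.prob M {\<omega>. - 1 * \<mu> + \<delta> * \<mu> \<le> - 1 * X \<omega>}"
    by (intro order_trans[OF measure_pmf.finite_measure_mono measure_Un_le]) auto
  also have "\<dots> \<le> exp (- (\<delta>\<^sup>2 * \<mu> / 4)) + exp (- (\<delta>\<^sup>2 * \<mu> / 4))"
    by (intro add_mono tail) auto
  finally show ?thesis by simp
qed

text \<open>The count is a sum of independent indicators of mean \<open>\<rho>\<close>, so its
  moment generating function is a power of \<open>1 + \<rho> * (exp s - 1)\<close>, and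
  \<open>1 + x \<le> exp x\<close> gives the Chernoff hypothesis. The relation \<open>R\<close> is
  conjunction when edges are random and inequality when colours are random.\<close>

lemma prob_card_pairs_concentrated:
  fixes R :: "'b \<Rightarrow> 'b \<Rightarrow> bool" and q :: "'b pmf"
  defines "\<rho> \<equiv> measure_pmf.prob (pair_pmf q q) {z. R (fst z) (snd z)}"
  assumes A: "finite A" and W: "finite W"
    and ab: "inj_on a W" "a ` W \<subseteq> A" "inj_on b W" "b ` W \<subseteq> A" "a ` W \<inter> b ` W = {}"
    and \<delta>: "0 \<le> \<delta>" "\<delta> \<le> 1"
  shows "measure_pmf.prob (Pi_pmf A dflt (\<lambda>_. q))
      {f. \<not> \<bar>real (card {w\<in>W. R (f (a w)) (f (b w))}) - real (card W) * \<rho>\<bar> \<le> \<delta> * (real (card W) * \<rho>)}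
    \<le> 2 * exp (- (\<delta>\<^sup>2 * (real (card W) * \<rho>) / 4))"
proof (rule chernoff_two_sided)
  show "0 \<le> real (card W) * \<rho>"
    by (simp add: \<rho>_def)
  fix s :: real
  let ?g = "\<lambda>x y. if R x y then ennreal (exp s) else 1"
  let ?S = "{z. R (fst z) (snd z)}"
  have "\<rho> \<le> 1" "0 \<le> \<rho>"
    by (simp_all add: \<rho>_def)
  have "ennreal (exp (s * real (card {w\<in>W. R (f (a w)) (f (b w))}))) = (\<Prod>w\<in>W. ?g (f (a w)) (f (b w)))" for f
    using W by (simp add: prod.If_cases Int_def ennreal_power exp_of_nat_mult[symmetric] mult.commute)
  then have "(\<integral>\<^sup>+f. ennreal (exp (s * real (card {w\<in>W. R (f (a w)) (f (b w))}))) \<partial>Pi_pmf A dflt (\<lambda>_. q)) =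
      (\<integral>\<^sup>+z. ?g (fst z) (snd z) \<partial>pair_pmf q q) ^ card W"
    using nn_integral_prod_pairs_Pi_pmf[OF A W ab, where g = ?g and dflt = dflt and q = q] by simp
  also have "(\<integral>\<^sup>+z. ?g (fst z) (snd z) \<partial>pair_pmf q q) =
      (\<integral>\<^sup>+z. ennreal (exp s) * indicator ?S z + indicator (- ?S) z \<partial>pair_pmf q q)"
    by (intro nn_integral_cong) (auto simp: indicator_def)
  also have "\<dots> = ennreal (exp s) * emeasure (pair_pmf q q) ?S + emeasure (pair_pmf q q) (- ?S)"
    by (subst nn_integral_add) (auto simp: nn_integral_cmult)
  also have "\<dots> = ennreal (exp s * \<rho> + (1 - \<rho>))"
  proof -
    have "measure_pmf.prob (pair_pmf q q) (- ?S) = 1 - \<rho>"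
      using measure_pmf.prob_compl[of ?S "pair_pmf q q"] by (simp add: \<rho>_def Compl_eq_Diff_UNIV)
    then show ?thesis
      using \<open>0 \<le> \<rho>\<close> \<open>\<rho> \<le> 1\<close>
      by (simp add: measure_pmf.emeasure_eq_measure \<rho>_def[symmetric] ennreal_mult[symmetric] ennreal_plus[symmetric] del: ennreal_plus)
  qed
  also have "\<dots> ^ card W \<le> ennreal (exp (\<rho> * (exp s - 1))) ^ card W"
    using exp_ge_add_one_self[of "\<rho> * (exp s - 1)"] by (intro power_mono ennreal_leI) (auto simp: algebra_simps)
  also have "\<dots> = ennreal (exp (real (card W) * \<rho> * (exp s - 1)))"
    by (simp add: ennreal_power exp_of_nat_mult[symmetric] mult.assoc)
  finally show "(\<integral>\<^sup>+f. ennreal (exp (s * real (card {w\<in>W. R (f (a w)) (f (b w))}))) \<partial>Pi_pmf A dflt (\<lambda>_. q)) \<le>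
      ennreal (exp (real (card W) * \<rho> * (exp s - 1)))" .
qed (use \<delta> in auto)

section \<open>Alternating paths of length 2 as common neighbours\<close>

text \<open>For \<open>u = v\<close> this is the neighbourhood of \<open>u\<close>, so that double
  counts can range over all ordered pairs. In a graph without loops neither \<open>u\<close> nor
  \<open>v\<close> is a member.\<close>

definition common_nbrs :: "'a set \<Rightarrow> 'a set set \<Rightarrow> 'a \<Rightarrow> 'a \<Rightarrow> 'a set" where
  "common_nbrs V E u v = {w \<in> V. {u, w} \<in> E \<and> {w, v} \<in> E}"

definition alt_nbrs :: "'a set \<Rightarrow> 'a set set \<Rightarrow> ('a set \<Rightarrow> nat) \<Rightarrow> 'a \<Rightarrow> 'a \<Rightarrow> 'a set" where
  "alt_nbrs V E c u v = {w \<in> common_nbrs V E u v. c {u, w} \<noteq> c {w, v}}"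

lemma singleton_notin_all_pairs [simp]: "{u, u} \<notin> all_pairs V" "{u} \<notin> all_pairs V"
  by (auto simp: all_pairs_def)

lemma finite_all_pairs: "finite V \<Longrightarrow> finite (all_pairs V)"
  by (auto simp: all_pairs_def intro: finite_subset[of _ "Pow V"])

lemma finite_nbrs [simp]:
  assumes "finite V"
  shows "finite (common_nbrs V E u v)" "finite (alt_nbrs V E c u v)"
  using assms by (auto simp: common_nbrs_def alt_nbrs_def)

text \<open>A middle vertex equal to an end would need a loop, so distinctness of the path is
  automatic.\<close>

lemma alternating_path_2_iff:
  assumes "E \<subseteq> all_pairs V" and "u \<in> V" "v \<in> V" "u \<noteq> v"
  shows "is_path V E 2 u v xs \<and> alternating c xs \<longleftrightarrow> (\<exists>w\<in>alt_nbrs V E c u v. xs = [u, w, v])"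
proof
  assume L: "is_path V E 2 u v xs \<and> alternating c xs"
  then obtain x w y where "xs = [x, w, y]"
    by (auto simp: is_path_def eval_nat_numeral length_Suc_conv)
  then have xs: "xs = [u, w, v]"
    using L by (auto simp: is_path_def)
  then have "w \<in> V" "{u, w} \<in> E" "{w, v} \<in> E" "c {u, w} \<noteq> c {w, v}"
    using L by (auto simp: is_path_def alternating_def dest: spec[of _ 0] spec[of _ "Suc 0"])
  then show "\<exists>w\<in>alt_nbrs V E c u v. xs = [u, w, v]"
    using xs by (auto simp: alt_nbrs_def common_nbrs_def)
next
  assume "\<exists>w\<in>alt_nbrs V E c u v. xs = [u, w, v]"
  then obtain w where w: "w \<in> alt_nbrs V E c u v" "xs = [u, w, v]"
    by auto
  then have "w \<noteq> u" "w \<noteq> v"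
    using assms by (auto simp: alt_nbrs_def common_nbrs_def)
  then show "is_path V E 2 u v xs \<and> alternating c xs"
    using w assms
    by (auto simp: is_path_def alternating_def alt_nbrs_def common_nbrs_def less_Suc_eq nth_Cons' eval_nat_numeral)
qed

text \<open>A path is determined by its middle vertex, which is also its only internal vertex; hence
  every set of admissible middle vertices yields an internally disjoint family, and no family is
  larger.\<close>

lemma alt_connected_2_iff:
  assumes V: "finite V" and E: "E \<subseteq> all_pairs V" and uv: "u \<in> V" "v \<in> V" "u \<noteq> v"
  shows "alt_connected V E c 2 t u v \<longleftrightarrow> t \<le> card (alt_nbrs V E c u v)"
proof
  assume "alt_connected V E c 2 t u v"
  then obtain P where P: "finite P" "card P = t" "disjoint_family_on internal_vertices P"
    and "\<And>xs. xs \<in> P \<Longrightarrow> is_path V E 2 u v xs \<and> alternating c xs"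
    unfolding alt_connected_def by blast
  then have path: "\<exists>w\<in>alt_nbrs V E c u v. xs = [u, w, v]" if "xs \<in> P" for xs
    using that alternating_path_2_iff[OF E uv] by blast
  have "P \<subseteq> (\<lambda>w. [u, w, v]) ` alt_nbrs V E c u v"
    using path by blast
  then have "card P \<le> card (alt_nbrs V E c u v)"
    using V by (intro surj_card_le[of _ _ "\<lambda>w. [u, w, v]"]) auto
  then show "t \<le> card (alt_nbrs V E c u v)"
    using P by simp
next
  assume "t \<le> card (alt_nbrs V E c u v)"
  then obtain W where W: "W \<subseteq> alt_nbrs V E c u v" "card W = t" "finite W"
    by (meson obtain_subset_with_card_n)
  have "disjoint_family_on internal_vertices ((\<lambda>w. [u, w, v]) ` W)"
    by (auto simp: disjoint_family_on_def internal_vertices_def)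
  moreover have "card ((\<lambda>w. [u, w, v]) ` W) = t"
    using W by (subst card_image) (auto simp: inj_on_def)
  ultimately show "alt_connected V E c 2 t u v"
    unfolding alt_connected_def using W alternating_path_2_iff[OF E uv]
    by (intro exI[of _ "(\<lambda>w. [u, w, v]) ` W"]) blast
qed

section \<open>The maximum defining \<open>kappa\<close> for length 2\<close>

context
  fixes V :: "'a set" and E :: "'a set set"
  assumes V: "finite V" "card V \<ge> 2" and E: "E \<subseteq> all_pairs V"
begin

lemma kappa_2_eq:
  "kappa r 2 V E = Max {t. \<exists>c. edge_coloring r E c \<and>
     (\<forall>u\<in>V. \<forall>v\<in>V. u \<noteq> v \<longrightarrow> t \<le> card (alt_nbrs V E c u v))}"
  by (simp add: kappa_def alt_connected_2_iff[OF V(1) E] cong: conj_cong ball_cong imp_cong)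

text \<open>A single pair of distinct vertices already confines \<open>t\<close> to at most
  \<open>card V\<close>. Finiteness is what gives \<open>Max\<close> its meaning.\<close>

lemma finite_kappa_2_set:
  "finite {t. \<exists>c. edge_coloring r E c \<and>
     (\<forall>u\<in>V. \<forall>v\<in>V. u \<noteq> v \<longrightarrow> t \<le> card (alt_nbrs V E c u v))}"
proof -
  obtain u v where uv: "u \<in> V" "v \<in> V" "u \<noteq> v"
    using V by (metis card_2_iff' obtain_subset_with_card_n subset_iff)
  have "card (alt_nbrs V E c u v) \<le> card V" for c
    using V by (intro card_mono) (auto simp: alt_nbrs_def common_nbrs_def)
  then show ?thesis
    using uv by (intro finite_subset[OF _ finite_atMost[of "card V"]]) (auto intro: order_trans)
qed

lemma kappa_2_ge:
  assumes "edge_coloring r E c"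
    and "\<And>u v. \<lbrakk>u \<in> V; v \<in> V; u \<noteq> v\<rbrakk> \<Longrightarrow> t \<le> card (alt_nbrs V E c u v)"
  shows "t \<le> kappa r 2 V E"
  unfolding kappa_2_eq using assms by (intro Max_ge finite_kappa_2_set) blast

lemma kappa_2_attained:
  assumes "r > 0"
  obtains c where "edge_coloring r E c"
    and "\<And>u v. \<lbrakk>u \<in> V; v \<in> V; u \<noteq> v\<rbrakk> \<Longrightarrow> kappa r 2 V E \<le> card (alt_nbrs V E c u v)"
proof -
  let ?T = "{t. \<exists>c. edge_coloring r E c \<and>
     (\<forall>u\<in>V. \<forall>v\<in>V. u \<noteq> v \<longrightarrow> t \<le> card (alt_nbrs V E c u v))}"
  \<comment> \<open>A constant colouring makes 0 admissible, so the maximum is over a nonempty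
    set.\<close>
  have "edge_coloring r E (\<lambda>_. 0)"
    using assms by (auto simp: edge_coloring_def)
  then have "0 \<in> ?T"
    by auto
  then have "kappa r 2 V E \<in> ?T"
    unfolding kappa_2_eq using finite_kappa_2_set[of r] by (intro Max_in) auto
  then show ?thesis
    using that by blast
qed

end

section \<open>Upper bound by double counting\<close>

text \<open>Cauchy--Schwarz for the sizes of the colour classes.\<close>

lemma sum_bichromatic_le:
  fixes k :: "'a \<Rightarrow> nat"
  assumes "finite S" and "k ` S \<subseteq> {..<r}" and "r > 0"
  shows "(\<Sum>u\<in>S. \<Sum>v\<in>S. of_bool (k u \<noteq> k v)) \<le> (1 - 1 / real r) * (real (card S))\<^sup>2"
proof -
  \<comment> \<open>\<open>m i\<close> is the size of colour class \<open>i\<close>. The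
    monochromatic ordered pairs number the sum of the squares of the \<open>m i\<close>.\<close>
  define m :: "nat \<Rightarrow> real" where "m i = (\<Sum>u\<in>S. of_bool (k u = i))" for i
  have color: "(\<Sum>i<r. of_bool (k u = i) * x) = x" if "u \<in> S" for u and x :: real
    using assms that by (subst sum.remove[of _ "k u"]) (auto intro!: sum.neutral)
  have "(\<Sum>i<r. m i) = (\<Sum>u\<in>S. \<Sum>i<r. of_bool (k u = i) * (1::real))"
    unfolding m_def by (subst sum.swap) simp
  also have "\<dots> = (\<Sum>u\<in>S. 1)"
    by (intro sum.cong refl color)
  finally have "(real (card S))\<^sup>2 \<le> (\<Sum>i<r. (m i)\<^sup>2) * real r"
    using sum_squared_le_sum_of_squares[of m "{..<r}"] by simp
  then have cs: "(real (card S))\<^sup>2 / real r \<le> (\<Sum>i<r. (m i)\<^sup>2)"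
    using assms by (simp add: pos_divide_le_eq)
  have "(\<Sum>i<r. (m i)\<^sup>2) = (\<Sum>u\<in>S. \<Sum>v\<in>S. \<Sum>i<r. of_bool (k u = i) * of_bool (k v = i))"
    unfolding m_def power2_eq_square sum_product
    by (subst sum.swap, intro sum.cong refl, subst sum.swap) simp
  also have "\<dots> = (\<Sum>u\<in>S. \<Sum>v\<in>S. \<Sum>i<r. of_bool (k u = i) * (1 - of_bool (k u \<noteq> k v)))"
    by (intro sum.cong refl) auto
  also have "\<dots> = (\<Sum>u\<in>S. \<Sum>v\<in>S. 1 - of_bool (k u \<noteq> k v))"
    by (intro sum.cong refl color)
  also have "\<dots> = (real (card S))\<^sup>2 - (\<Sum>u\<in>S. \<Sum>v\<in>S. of_bool (k u \<noteq> k v))"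
    by (simp add: sum_subtractf power2_eq_square)
  finally show ?thesis
    using cs by (simp add: algebra_simps)
qed

lemma real_card_Collect: "finite V \<Longrightarrow> real (card {w \<in> V. P w}) = (\<Sum>w\<in>V. of_bool (P w))"
  by (simp add: Int_def)

text \<open>Group by the middle vertex \<open>w\<close>: then \<open>u\<close> and \<open>v\<close>
  range independently over its neighbours \<open>S w\<close>, coloured by their edges to
  \<open>w\<close>, and the bound on bichromatic pairs applies to each \<open>S w\<close>.\<close>

lemma sum_alt_nbrs_le:
  assumes V: "finite V" and c: "edge_coloring r E c" and r: "r > 0"
  shows "(\<Sum>u\<in>V. \<Sum>v\<in>V. real (card (alt_nbrs V E c u v)))
    \<le> (1 - 1 / real r) * (\<Sum>u\<in>V. \<Sum>v\<in>V. real (card (common_nbrs V E u v)))"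
proof -
  define S where "S w = {u \<in> V. {u, w} \<in> E}" for w
  have swap: "(\<Sum>u\<in>V. \<Sum>v\<in>V. real (card {w \<in> V. {u, w} \<in> E \<and> {w, v} \<in> E \<and> Q u v w})) =
      (\<Sum>w\<in>V. \<Sum>u\<in>S w. \<Sum>v\<in>S w. of_bool (Q u v w))" for Q
  proof -
    have "(\<Sum>u\<in>V. \<Sum>v\<in>V. real (card {w \<in> V. {u, w} \<in> E \<and> {w, v} \<in> E \<and> Q u v w})) =
        (\<Sum>u\<in>V. \<Sum>v\<in>V. \<Sum>w\<in>V. of_bool ({u, w} \<in> E \<and> {w, v} \<in> E \<and> Q u v w))"
      using V by (simp add: real_card_Collect del: sum_of_bool_eq)
    also have "\<dots> = (\<Sum>u\<in>V. \<Sum>w\<in>V. \<Sum>v\<in>V. of_bool ({u, w} \<in> E \<and> {w, v} \<in> E \<and> Q u v w))"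
      by (intro sum.cong refl sum.swap)
    also have "\<dots> = (\<Sum>w\<in>V. \<Sum>u\<in>V. \<Sum>v\<in>V. of_bool ({u, w} \<in> E \<and> {w, v} \<in> E \<and> Q u v w))"
      by (rule sum.swap)
    also have "\<dots> = (\<Sum>w\<in>V. \<Sum>u\<in>S w. \<Sum>v\<in>S w. of_bool (Q u v w))"
    proof (rule sum.cong[OF refl])
      fix w
      have "(\<Sum>u\<in>V. \<Sum>v\<in>V. of_bool ({u, w} \<in> E \<and> {w, v} \<in> E \<and> Q u v w)) =
          (\<Sum>u\<in>V. if {u, w} \<in> E then (\<Sum>v\<in>V. if {v, w} \<in> E then of_bool (Q u v w) else 0) else (0::real))"
        by (intro sum.cong refl) (auto intro!: sum.cong sum.neutral simp: insert_commute)
      also have "\<dots> = (\<Sum>u\<in>S w. \<Sum>v\<in>S w. of_bool (Q u v w))"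
        using V by (simp only: S_def sum.inter_filter)
      finally show "(\<Sum>u\<in>V. \<Sum>v\<in>V. of_bool ({u, w} \<in> E \<and> {w, v} \<in> E \<and> Q u v w)) =
          (\<Sum>u\<in>S w. \<Sum>v\<in>S w. of_bool (Q u v w) :: real)" .
    qed
    finally show ?thesis .
  qed
  have "(\<Sum>u\<in>V. \<Sum>v\<in>V. real (card (alt_nbrs V E c u v))) =
      (\<Sum>w\<in>V. \<Sum>u\<in>S w. \<Sum>v\<in>S w. of_bool (c {u, w} \<noteq> c {v, w}))"
    using swap[of "\<lambda>u v w. c {u, w} \<noteq> c {v, w}"]
    by (simp add: alt_nbrs_def common_nbrs_def insert_commute conj_assoc del: sum_of_bool_eq)
  also have "\<dots> \<le> (\<Sum>w\<in>V. (1 - 1 / real r) * (real (card (S w)))\<^sup>2)"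
    using V c r by (intro sum_mono sum_bichromatic_le) (auto simp: S_def edge_coloring_def)
  \<comment> \<open>As a double sum of \<open>of_bool True\<close> the square fits
    \<open>swap\<close> with the trivial condition.\<close>
  also have "\<dots> = (1 - 1 / real r) * (\<Sum>w\<in>V. \<Sum>u\<in>S w. \<Sum>v\<in>S w. of_bool True)"
    by (simp add: sum_distrib_left power2_eq_square)
  also have "(\<Sum>w\<in>V. \<Sum>u\<in>S w. \<Sum>v\<in>S w. of_bool True) = (\<Sum>u\<in>V. \<Sum>v\<in>V. real (card (common_nbrs V E u v)))"
    using swap[of "\<lambda>_ _ _. True"] by (simp add: common_nbrs_def)
  finally show ?thesis .
qed

text \<open>Average over the \<open>n * (n - 1)\<close> ordered pairs of distinct vertices. The
  diagonal adds a degree, at most \<open>n\<close>, for each vertex;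
  \<open>n \<le> 2 * (n - 1)\<close> turns this into the summand 2.\<close>

lemma kappa_2_upper_bound:
  assumes V: "finite V" "card V \<ge> 2" and E: "E \<subseteq> all_pairs V" and r: "r > 0"
    and C: "\<And>u v. \<lbrakk>u \<in> V; v \<in> V; u \<noteq> v\<rbrakk> \<Longrightarrow> real (card (common_nbrs V E u v)) \<le> C"
  shows "real (kappa r 2 V E) \<le> (1 - 1 / real r) * (C + 2)"
proof -
  define n where "n = real (card V)"
  have n: "n \<ge> 2"
    using V by (simp add: n_def)
  obtain c where c: "edge_coloring r E c"
    and ge: "\<And>u v. \<lbrakk>u \<in> V; v \<in> V; u \<noteq> v\<rbrakk> \<Longrightarrow> kappa r 2 V E \<le> card (alt_nbrs V E c u v)"
    using kappa_2_attained[OF V E r] by metis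
  have split: "(\<Sum>v\<in>V. f v) = f u + (\<Sum>v\<in>V - {u}. f v)" if "u \<in> V" for u and f :: "'a \<Rightarrow> real"
    using V(1) that by (rule sum.remove)
  have const: "(\<Sum>v\<in>V - {u}. x) = (n - 1) * x" if "u \<in> V" for u and x :: real
    using V that by (simp add: n_def of_nat_diff)
  have "n * ((n - 1) * real (kappa r 2 V E)) = (\<Sum>u\<in>V. (n - 1) * real (kappa r 2 V E))"
    by (simp add: n_def)
  also have "\<dots> = (\<Sum>u\<in>V. \<Sum>v\<in>V - {u}. real (kappa r 2 V E))"
    by (intro sum.cong refl const[symmetric])
  also have "\<dots> \<le> (\<Sum>u\<in>V. \<Sum>v\<in>V. real (card (alt_nbrs V E c u v)))"
  proof (rule sum_mono)
    fix u assume u: "u \<in> V"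
    have "(\<Sum>v\<in>V - {u}. real (kappa r 2 V E)) \<le> (\<Sum>v\<in>V - {u}. real (card (alt_nbrs V E c u v)))"
      using u by (intro sum_mono) (auto intro: ge)
    then show "(\<Sum>v\<in>V - {u}. real (kappa r 2 V E)) \<le> (\<Sum>v\<in>V. real (card (alt_nbrs V E c u v)))"
      using u by (simp add: split)
  qed
  also have "\<dots> \<le> (1 - 1 / real r) * (\<Sum>u\<in>V. \<Sum>v\<in>V. real (card (common_nbrs V E u v)))"
    by (rule sum_alt_nbrs_le[OF V(1) c r])
  also have "\<dots> \<le> (1 - 1 / real r) * (\<Sum>u\<in>V. n + (n - 1) * C)"
  proof (intro mult_left_mono sum_mono)
    fix u assume u: "u \<in> V"
    have "card (common_nbrs V E u u) \<le> card V"
      using V by (intro card_mono) (auto simp: common_nbrs_def)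
    moreover have "(\<Sum>v\<in>V - {u}. real (card (common_nbrs V E u v))) \<le> (n - 1) * C"
      using u by (subst const[OF u, symmetric], intro sum_mono C) auto
    ultimately show "(\<Sum>v\<in>V. real (card (common_nbrs V E u v))) \<le> n + (n - 1) * C"
      using u by (simp add: split n_def)
  qed (use r in auto)
  also have "\<dots> \<le> (1 - 1 / real r) * (n * ((n - 1) * (C + 2)))"
  proof (intro mult_left_mono)
    have "n + (n - 1) * C \<le> (n - 1) * (C + 2)"
      using n by (simp add: algebra_simps)
    then show "(\<Sum>u\<in>V. n + (n - 1) * C) \<le> n * ((n - 1) * (C + 2))"
      using n by (simp add: n_def[symmetric])
  qed (use r in auto)
  finally have "(n * (n - 1)) * real (kappa r 2 V E) \<le> (n * (n - 1)) * ((1 - 1 / real r) * (C + 2))"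
    by (simp only: mult_ac)
  then show ?thesis
    using n by (subst (asm) mult_le_cancel_left_pos) auto
qed

section \<open>Union bounds, random colourings and the lower bound\<close>

lemma prob_union_bound:
  fixes M :: "'a pmf"
  assumes "finite I" and "\<And>i. i \<in> I \<Longrightarrow> measure_pmf.prob M {\<omega>. Q i \<omega>} \<le> B"
  shows "measure_pmf.prob M {\<omega>. \<exists>i\<in>I. Q i \<omega>} \<le> real (card I) * B"
proof -
  have "measure_pmf.prob M {\<omega>. \<exists>i\<in>I. Q i \<omega>} = measure_pmf.prob M (\<Union>i\<in>I. {\<omega>. Q i \<omega>})"
    by (intro arg_cong[of _ _ "measure_pmf.prob M"]) auto
  also have "\<dots> \<le> (\<Sum>i\<in>I. measure_pmf.prob M {\<omega>. Q i \<omega>})"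
    using assms by (intro measure_pmf.finite_measure_subadditive_finite) auto
  also have "\<dots> \<le> real (card I) * B"
    using assms by (intro sum_bounded_above) auto
  finally show ?thesis .
qed

lemma prob_union_bound_distinct_pairs:
  fixes M :: "'b pmf"
  assumes "finite V" and "B \<ge> 0"
    and "\<And>u v. \<lbrakk>u \<in> V; v \<in> V; u \<noteq> v\<rbrakk> \<Longrightarrow> measure_pmf.prob M {\<omega>. Q u v \<omega>} \<le> B"
  shows "measure_pmf.prob M {\<omega>. \<exists>u\<in>V. \<exists>v\<in>V. u \<noteq> v \<and> Q u v \<omega>} \<le> (real (card V))\<^sup>2 * B"
proof -
  let ?I = "{(u, v) \<in> V \<times> V. u \<noteq> v}"
  have fin: "finite ?I"
    using assms(1) by (auto intro: finite_subset[of _ "V \<times> V"])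
  have "measure_pmf.prob M {\<omega>. \<exists>u\<in>V. \<exists>v\<in>V. u \<noteq> v \<and> Q u v \<omega>} =
      measure_pmf.prob M {\<omega>. \<exists>i\<in>?I. Q (fst i) (snd i) \<omega>}"
    by (intro arg_cong[of _ _ "measure_pmf.prob M"]) auto
  also have "\<dots> \<le> real (card ?I) * B"
    using fin assms(3) by (intro prob_union_bound) auto
  also have "\<dots> \<le> real (card (V \<times> V)) * B"
    using assms by (intro mult_right_mono of_nat_mono card_mono) auto
  finally show ?thesis
    by (simp add: card_cartesian_product power2_eq_square)
qed

lemma inj_on_doubleton: "inj_on (\<lambda>w. {u, w}) W" "inj_on (\<lambda>w. {w, u}) W"
  by (auto simp: inj_on_def doubleton_eq_iff)

lemma prob_neq_pmf_of_set:
  fixes A :: "'a set"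
  assumes "finite A" "A \<noteq> {}"
  shows "measure_pmf.prob (pair_pmf (pmf_of_set A) (pmf_of_set A)) {z. fst z \<noteq> snd z} = 1 - 1 / real (card A)"
proof -
  have "A \<times> A \<inter> {z. fst z = snd z} = (\<lambda>x. (x, x)) ` A"
    by auto
  then have "card (A \<times> A \<inter> {z. fst z = snd z}) = card A"
    by (simp add: card_image inj_on_def)
  then have "measure_pmf.prob (pmf_of_set (A \<times> A)) {z. fst z = snd z} = 1 / real (card A)"
    using assms by (simp add: measure_pmf_of_set card_cartesian_product)
  moreover have "pair_pmf (pmf_of_set A) (pmf_of_set A) = pmf_of_set (A \<times> A)"
    using assms by (intro pmf_eqI) (simp add: split_paired_all pmf_pair card_cartesian_product indicator_def)
  ultimately show ?thesis
    using measure_pmf.prob_neg[of "pmf_of_set (A \<times> A)" "\<lambda>z. fst z = snd z"] by simp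
qed

text \<open>A uniformly random colouring has the required property with positive probability.\<close>

lemma kappa_2_lower_bound:
  assumes V: "finite V" "card V \<ge> 2" and E: "E \<subseteq> all_pairs V" and r: "r > 0"
    and \<delta>: "0 \<le> \<delta>" "\<delta> \<le> 1"
    and D: "\<And>u v. \<lbrakk>u \<in> V; v \<in> V; u \<noteq> v\<rbrakk> \<Longrightarrow> D \<le> real (card (common_nbrs V E u v))"
    and small: "(real (card V))\<^sup>2 * (2 * exp (- (\<delta>\<^sup>2 * ((1 - 1 / real r) * D) / 4))) < 1"
  shows "(1 - \<delta>) * ((1 - 1 / real r) * D) \<le> real (kappa r 2 V E)"
proof -
  define \<rho> where "\<rho> = 1 - 1 / real r"
  have \<rho>: "0 \<le> \<rho>"
    using r by (simp add: \<rho>_def)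
  define M where "M = Pi_pmf E 0 (\<lambda>_. pmf_of_set {..<r})"
  define Q where "Q u v c \<longleftrightarrow> \<not> \<bar>real (card (alt_nbrs V E c u v)) - real (card (common_nbrs V E u v)) * \<rho>\<bar>
      \<le> \<delta> * (real (card (common_nbrs V E u v)) * \<rho>)" for u v and c :: "'a set \<Rightarrow> nat"
  have finE: "finite E"
    using E V finite_all_pairs finite_subset by blast
  have "measure_pmf.prob M {c. Q u v c} \<le> 2 * exp (- (\<delta>\<^sup>2 * (\<rho> * D) / 4))"
    if uv: "u \<in> V" "v \<in> V" "u \<noteq> v" for u v
  proof -
    let ?W = "common_nbrs V E u v"
    \<comment> \<open>A shared edge would make \<open>v\<close> a common neighbour of
      \<open>u\<close> and \<open>v\<close>, which needs a loop at \<open>v\<close>.\<close>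
    have disj: "(\<lambda>w. {u, w}) ` ?W \<inter> (\<lambda>w. {w, v}) ` ?W = {}"
      using E uv by (auto simp: common_nbrs_def doubleton_eq_iff)
    have "measure_pmf.prob M {c. Q u v c} \<le> 2 * exp (- (\<delta>\<^sup>2 * (real (card ?W) * \<rho>) / 4))"
      using prob_card_pairs_concentrated[OF finE _ inj_on_doubleton(1) _ inj_on_doubleton(2) _ disj \<delta>,
          where R = "(\<noteq>)" and q = "pmf_of_set {..<r}" and dflt = 0] r V
      by (auto simp: prob_neq_pmf_of_set lessThan_empty_iff M_def Q_def alt_nbrs_def \<rho>_def common_nbrs_def)
    \<comment> \<open>More common neighbours only shrink the tail, so \<open>D\<close> gives one
      bound for all pairs.\<close>
    also have "\<dots> \<le> 2 * exp (- (\<delta>\<^sup>2 * (\<rho> * D) / 4))"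
      using D[OF uv] \<rho> by (simp add: mult_left_mono mult.commute[of _ \<rho>])
    finally show ?thesis .
  qed
  then have "measure_pmf.prob M {c. \<exists>u\<in>V. \<exists>v\<in>V. u \<noteq> v \<and> Q u v c}
      \<le> (real (card V))\<^sup>2 * (2 * exp (- (\<delta>\<^sup>2 * (\<rho> * D) / 4)))"
    using V by (intro prob_union_bound_distinct_pairs) auto
  also have "\<dots> < 1"
    using small by (simp add: \<rho>_def)
  finally have "\<not> (AE c in M. \<exists>u\<in>V. \<exists>v\<in>V. u \<noteq> v \<and> Q u v c)"
    using measure_pmf.prob_Collect_eq_1[of M "\<lambda>c. \<exists>u\<in>V. \<exists>v\<in>V. u \<noteq> v \<and> Q u v c"] by auto
  then obtain c where c: "c \<in> set_pmf M" and good: "\<And>u v. \<lbrakk>u \<in> V; v \<in> V; u \<noteq> v\<rbrakk> \<Longrightarrow> \<not> Q u v c"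
    by (auto simp: AE_measure_pmf_iff)
  have col: "edge_coloring r E c"
    using c r finE by (auto simp: M_def set_Pi_pmf PiE_dflt_def edge_coloring_def lessThan_empty_iff)
  \<comment> \<open>The real bound is rounded up, since \<open>kappa\<close> is a maximum of natural
    numbers.\<close>
  have "nat \<lceil>(1 - \<delta>) * (\<rho> * D)\<rceil> \<le> card (alt_nbrs V E c u v)" if uv: "u \<in> V" "v \<in> V" "u \<noteq> v" for u v
  proof -
    have "(1 - \<delta>) * (\<rho> * D) \<le> (1 - \<delta>) * (\<rho> * real (card (common_nbrs V E u v)))"
      using D[OF uv] \<rho> \<delta> by (intro mult_left_mono) auto
    also have "\<dots> \<le> real (card (alt_nbrs V E c u v))"
      using good[OF uv] by (auto simp: Q_def abs_le_iff algebra_simps)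
    finally show ?thesis
      by (simp add: nat_le_iff ceiling_le_iff)
  qed
  then have "nat \<lceil>(1 - \<delta>) * (\<rho> * D)\<rceil> \<le> kappa r 2 V E"
    by (intro kappa_2_ge[OF V E col])
  then show ?thesis
    unfolding \<rho>_def[symmetric] by (simp add: nat_le_iff ceiling_le_iff)
qed

section \<open>Codegrees of the random graph\<close>

lemma prob_both_bernoulli:
  assumes "0 \<le> p" "p \<le> 1"
  shows "measure_pmf.prob (pair_pmf (bernoulli_pmf p) (bernoulli_pmf p)) {z. fst z \<and> snd z} = p\<^sup>2"
proof -
  have "{z. fst z \<and> snd z} = {True} \<times> {True}"
    by auto
  then show ?thesis
    using assms by (simp add: pmf_pair measure_pmf_single power2_eq_square)
qed

text \<open>A codegree is a sum of \<open>n - 2\<close> independent indicators of mean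
  \<open>p\<^sup>2\<close>, one for each vertex other than \<open>u\<close> and \<open>v\<close>.
  The factor \<open>n\<^sup>2\<close> comes from the union bound over ordered pairs.\<close>

lemma Gnp_codegrees_concentrated:
  assumes n: "n \<ge> 2" and p: "0 \<le> p" "p \<le> 1" and \<delta>: "0 \<le> \<delta>" "\<delta> \<le> 1"
  defines "\<mu> \<equiv> (real n - 2) * p\<^sup>2"
  shows "measure_pmf.prob (Gnp n p) {E. \<not> (E \<subseteq> all_pairs {..<n} \<and>
      (\<forall>u<n. \<forall>v<n. u \<noteq> v \<longrightarrow> \<bar>real (card (common_nbrs {..<n} E u v)) - \<mu>\<bar> \<le> \<delta> * \<mu>))}
    \<le> (real n)\<^sup>2 * (2 * exp (- (\<delta>\<^sup>2 * \<mu> / 4)))"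
proof -
  let ?V = "{..<n}"
  define M where "M = Pi_pmf (all_pairs ?V) False (\<lambda>_. bernoulli_pmf p)"
  define Q where "Q u v f \<longleftrightarrow>
      \<not> \<bar>real (card (common_nbrs ?V {e \<in> all_pairs ?V. f e} u v)) - \<mu>\<bar> \<le> \<delta> * \<mu>" for u v f
  have "measure_pmf.prob M {f. Q u v f} \<le> 2 * exp (- (\<delta>\<^sup>2 * \<mu> / 4))"
    if uv: "u \<in> ?V" "v \<in> ?V" "u \<noteq> v" for u v
  proof -
    let ?W = "?V - {u, v}"
    have card: "real (card ?W) = real n - 2"
      using uv n by (simp add: card_Diff_subset of_nat_diff)
    have nbrs: "common_nbrs ?V {e \<in> all_pairs ?V. f e} u v = {w \<in> ?W. f {u, w} \<and> f {w, v}}" for f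
      using uv by (auto simp: common_nbrs_def all_pairs_def card_2_iff doubleton_eq_iff)
    have disj: "(\<lambda>w. {u, w}) ` ?W \<inter> (\<lambda>w. {w, v}) ` ?W = {}"
      using uv by (auto simp: doubleton_eq_iff)
    have sub: "(\<lambda>w. {u, w}) ` ?W \<subseteq> all_pairs ?V" "(\<lambda>w. {w, v}) ` ?W \<subseteq> all_pairs ?V"
      using uv by (auto simp: all_pairs_def)
    show ?thesis
      using prob_card_pairs_concentrated[OF finite_all_pairs _ inj_on_doubleton(1) sub(1)
          inj_on_doubleton(2) sub(2) disj \<delta>, where R = "(\<and>)" and q = "bernoulli_pmf p" and dflt = False] p
      by (simp add: prob_both_bernoulli card M_def Q_def nbrs \<mu>_def)
  qed
  then have "measure_pmf.prob M {f. \<exists>u\<in>?V. \<exists>v\<in>?V. u \<noteq> v \<and> Q u v f}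
      \<le> (real (card ?V))\<^sup>2 * (2 * exp (- (\<delta>\<^sup>2 * \<mu> / 4)))"
    by (intro prob_union_bound_distinct_pairs) auto
  moreover have "measure_pmf.prob (Gnp n p) {E. \<not> (E \<subseteq> all_pairs {..<n} \<and>
      (\<forall>u<n. \<forall>v<n. u \<noteq> v \<longrightarrow> \<bar>real (card (common_nbrs {..<n} E u v)) - \<mu>\<bar> \<le> \<delta> * \<mu>))} =
      measure_pmf.prob M {f. \<exists>u\<in>?V. \<exists>v\<in>?V. u \<noteq> v \<and> Q u v f}"
    unfolding Gnp_def M_def[symmetric] measure_map_pmf
    by (intro arg_cong[of _ _ "measure_pmf.prob M"]) (auto simp: Q_def)
  ultimately show ?thesis
    by simp
qed

text \<open>Square the little-o bound taken with constant \<open>1 / sqrt K\<close>. In this form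
  the hypothesis on \<open>p\<close> lets the Chernoff exponent beat any fixed power of
  \<open>n\<close>.\<close>

lemma eventually_ln_le_of_sqrt_ln_smallo:
  fixes p :: "nat \<Rightarrow> real"
  assumes "(\<lambda>n. sqrt (ln (real n) / real n)) \<in> o(p)" and "K > 0"
  shows "eventually (\<lambda>n. K * ln (real n) \<le> real n * (p n)\<^sup>2) sequentially"
proof -
  define c where "c = 1 / sqrt K"
  have c: "c > 0" "c\<^sup>2 = 1 / K"
    using assms(2) by (auto simp: c_def power_divide)
  have "eventually (\<lambda>n. norm (sqrt (ln (real n) / real n)) \<le> c * norm (p n)) sequentially"
    using landau_o.smallD[OF assms(1) c(1)] .
  then show ?thesis
    using eventually_ge_at_top[of 1]
  proof eventually_elim
    case (elim n)
    then have "(sqrt (ln (real n) / real n))\<^sup>2 \<le> (c * \<bar>p n\<bar>)\<^sup>2"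
      by (intro power_mono) auto
    then have "ln (real n) / real n \<le> (p n)\<^sup>2 / K"
      using elim c by (simp add: power_mult_distrib)
    then show ?case
      using elim assms(2) by (simp add: field_simps)
  qed
qed

section \<open>Choice of constants and passage to the limit\<close>

theorem theorem1p1:
  fixes r :: nat and p :: "nat \<Rightarrow> real"
  assumes "r > 0"
    and "\<And>n. 0 \<le> p n \<and> p n \<le> 1"
    and "(\<lambda>n. sqrt (ln (real n) / real n)) \<in> o(p)"
  shows "whp_asymp_equiv (\<lambda>n. Gnp n (p n))
           (\<lambda>n E. real (kappa r 2 {..<n} E))
           (\<lambda>n. (1 - 1 / real r) * real n * (p n)\<^sup>2)"
  unfolding whp_asymp_equiv_def
proof (intro allI impI)
  fix \<epsilon> :: real assume "\<epsilon> > 0"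
  define \<rho> where "\<rho> = 1 - 1 / real r"
  define \<mu> where "\<mu> n = real n * (p n)\<^sup>2" for n
  \<comment> \<open>The lower bound loses a factor \<open>1 - \<delta>\<close> three times: in
    passing from \<open>n\<close> to \<open>n - 2\<close>, in the codegrees and in the colouring.
    The upper bound spends \<open>\<delta>\<close> twice: on the codegrees and on the additive
    2.\<close>
  define \<delta> where "\<delta> = min (1 / 2) (\<epsilon> / 3)"
  have \<delta>: "0 < \<delta>" "\<delta> \<le> 1 / 2" "3 * \<delta> \<le> \<epsilon>"
    using \<open>\<epsilon> > 0\<close> by (auto simp: \<delta>_def)
  have \<rho>: "0 \<le> \<rho>" "r \<noteq> 1 \<Longrightarrow> 1 / 2 \<le> \<rho>" "r = 1 \<Longrightarrow> \<rho> = 0"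
    using assms(1) by (auto simp: \<rho>_def field_simps)
  define P where "P n = measure_pmf.prob (Gnp n (p n))
      {E. \<bar>real (kappa r 2 {..<n} E) - \<rho> * real n * (p n)\<^sup>2\<bar> \<le> \<epsilon> * \<bar>\<rho> * real n * (p n)\<^sup>2\<bar>}" for n
  \<comment> \<open>\<open>96 = 3 * 4 * 8\<close>: an exponent
    \<open>\<delta>\<^sup>2 * x / 4\<close> with \<open>x\<close> at least
    \<open>\<mu> n / 8\<close> must reach \<open>3 * ln n\<close>, which beats the
    \<open>n\<^sup>2\<close> pairs and leaves \<open>2 / n\<close>.\<close>
  have "eventually (\<lambda>n. (96 / \<delta>\<^sup>2) * ln (real n) \<le> \<mu> n) sequentially"
    unfolding \<mu>_def using \<delta> by (intro eventually_ln_le_of_sqrt_ln_smallo[OF assms(3)]) auto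
  \<comment> \<open>With the previous bound this gives \<open>2 \<le> \<delta> * \<mu> n\<close>,
    which absorbs the additive 2 of the upper bound.\<close>
  moreover have "eventually (\<lambda>n. 2 / \<delta> \<le> (96 / \<delta>\<^sup>2) * ln (real n)) sequentially"
    using \<delta> by real_asymp
  \<comment> \<open>The first absorbs the two vertices missing from \<open>n - 2\<close>; the second
    makes \<open>2 / n\<close> less than 1.\<close>
  moreover have "eventually (\<lambda>n. 2 / \<delta> \<le> real n) sequentially" "eventually (\<lambda>n. 4 \<le> n) sequentially"
    by (rule eventually_ge_at_top | real_asymp)+
  ultimately have lower: "eventually (\<lambda>n. 1 - 2 / real n \<le> P n) sequentially"
  proof eventually_elim
    case (elim n)
    define m where "m = (real n - 2) * (p n)\<^sup>2"
    let ?V = "{..<n}"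
    define Good where "Good E \<longleftrightarrow> E \<subseteq> all_pairs ?V \<and>
      (\<forall>u<n. \<forall>v<n. u \<noteq> v \<longrightarrow> \<bar>real (card (common_nbrs ?V E u v)) - m\<bar> \<le> \<delta> * m)" for E
    have "2 / \<delta> \<le> \<mu> n"
      using elim by linarith
    then have \<mu>2: "2 \<le> \<delta> * \<mu> n" and \<mu>: "0 \<le> \<mu> n" and n2: "2 \<le> \<delta> * real n"
      using elim(3) \<delta> by (simp_all add: pos_divide_le_eq mult.commute \<mu>_def)
    have m: "m \<le> \<mu> n" "(1 - \<delta>) * \<mu> n \<le> m" "\<mu> n / 2 \<le> m"
    proof -
      show "m \<le> \<mu> n"
        by (simp add: m_def \<mu>_def mult_right_mono)
      have "(1 - \<delta>) * real n \<le> real n - 2"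
        using n2 by (simp add: algebra_simps)
      then show 1: "(1 - \<delta>) * \<mu> n \<le> m"
        unfolding m_def \<mu>_def mult.assoc[symmetric] by (intro mult_right_mono) auto
      have "1 / 2 * \<mu> n \<le> (1 - \<delta>) * \<mu> n"
        using \<delta> \<mu> by (intro mult_right_mono) auto
      then show "\<mu> n / 2 \<le> m"
        using 1 by simp
    qed
    \<comment> \<open>The threshold \<open>\<mu> n / 8\<close> serves both applications:
      \<open>m\<close> is at least \<open>\<mu> n / 2\<close>, and \<open>\<rho> * D\<close> below
      is at least \<open>1 / 2 * (1 / 4 * \<mu> n)\<close>.\<close>
    have small: "(real n)\<^sup>2 * (2 * exp (- (\<delta>\<^sup>2 * x / 4))) \<le> 2 / real n" if "\<mu> n / 8 \<le> x" for x
    proof -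
      have "96 * ln (real n) \<le> \<delta>\<^sup>2 * \<mu> n"
        using elim \<delta> by (simp add: field_simps)
      also have "\<dots> \<le> \<delta>\<^sup>2 * (8 * x)"
        using that by (intro mult_left_mono) auto
      finally have "3 * ln (real n) \<le> \<delta>\<^sup>2 * x / 4"
        by (simp add: mult.commute)
      then have "exp (- (\<delta>\<^sup>2 * x / 4)) \<le> exp (- (3 * ln (real n)))"
        by simp
      also have "\<dots> = 1 / real n ^ 3"
        using elim exp_of_nat_mult[of 3 "ln (real n)"] by (simp add: exp_minus field_simps)
      finally have "(real n)\<^sup>2 * (2 * exp (- (\<delta>\<^sup>2 * x / 4))) \<le> (real n)\<^sup>2 * (2 * (1 / real n ^ 3))"
        by (intro mult_left_mono) auto
      then show ?thesis
        using elim by (simp add: power2_eq_square power3_eq_cube)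
    qed
    have "\<bar>real (kappa r 2 ?V E) - \<rho> * \<mu> n\<bar> \<le> \<epsilon> * (\<rho> * \<mu> n)" if "Good E" for E
    proof -
      have E: "E \<subseteq> all_pairs ?V"
        and cod: "\<And>u v. \<lbrakk>u \<in> ?V; v \<in> ?V; u \<noteq> v\<rbrakk> \<Longrightarrow> \<bar>real (card (common_nbrs ?V E u v)) - m\<bar> \<le> \<delta> * m"
        using that by (auto simp: Good_def)
      have V: "finite ?V" "2 \<le> card ?V"
        using elim by auto
      have \<delta>m: "\<delta> * m \<le> \<delta> * \<mu> n"
        using m \<delta> by (intro mult_left_mono) auto
      have "real (card (common_nbrs ?V E u v)) \<le> \<mu> n + \<delta> * \<mu> n"
        if "u \<in> ?V" "v \<in> ?V" "u \<noteq> v" for u v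
        using cod[OF that] m(1) \<delta>m by linarith
      then have "real (kappa r 2 ?V E) \<le> \<rho> * (\<mu> n + \<delta> * \<mu> n + 2)"
        unfolding \<rho>_def by (intro kappa_2_upper_bound[OF V E assms(1)]) auto
      also have "\<dots> \<le> \<rho> * (\<mu> n + \<epsilon> * \<mu> n)"
      proof (intro mult_left_mono)
        have "2 * \<delta> * \<mu> n \<le> \<epsilon> * \<mu> n"
          using \<delta> \<mu> by (intro mult_right_mono) auto
        then show "\<mu> n + \<delta> * \<mu> n + 2 \<le> \<mu> n + \<epsilon> * \<mu> n"
          using \<mu>2 by simp
      qed (fact \<rho>)
      finally have up: "real (kappa r 2 ?V E) \<le> \<rho> * \<mu> n + \<epsilon> * (\<rho> * \<mu> n)"
        by (simp add: algebra_simps)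
      have low: "(1 - \<epsilon>) * (\<rho> * \<mu> n) \<le> real (kappa r 2 ?V E)"
      proof (cases "r = 1")
        \<comment> \<open>With one colour \<open>\<rho> = 0\<close> and the claim is trivial;
          otherwise \<open>\<rho>\<close> is at least \<open>1 / 2\<close>, which keeps the exponent
          for the random colouring large.\<close>
        case True
        then show ?thesis
          using \<rho> by simp
      next
        case False
        \<comment> \<open>One factor \<open>1 - \<delta>\<close> compares \<open>m\<close> with
          \<open>\<mu> n\<close>, the other is the deviation of the codegrees from
          \<open>m\<close>.\<close>
        define D where "D = (1 - \<delta>)\<^sup>2 * \<mu> n"
        have "D \<le> (1 - \<delta>) * m"
          using m(2) \<delta> unfolding D_def power2_eq_square mult.assoc by (intro mult_left_mono) auto
        then have D: "D \<le> real (card (common_nbrs ?V E u v))" if "u \<in> ?V" "v \<in> ?V" "u \<noteq> v" for u v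
          using cod[OF that] by (simp add: algebra_simps abs_le_iff)
        have "(1 / 2)\<^sup>2 \<le> (1 - \<delta>)\<^sup>2"
          using \<delta> by (intro power_mono) auto
        then have "1 / 4 * \<mu> n \<le> D"
          unfolding D_def using \<mu> by (intro mult_right_mono) (auto simp: power2_eq_square)
        then have "1 / 2 * (1 / 4 * \<mu> n) \<le> \<rho> * D"
          using \<rho>(2)[OF False] \<mu> by (intro mult_mono) auto
        then have "(real n)\<^sup>2 * (2 * exp (- (\<delta>\<^sup>2 * (\<rho> * D) / 4))) \<le> 2 / real n"
          by (intro small) auto
        also have "\<dots> < 1"
          using elim by simp
        finally have "(1 - \<delta>) * (\<rho> * D) \<le> real (kappa r 2 ?V E)"
          unfolding \<rho>_def using \<delta> D by (intro kappa_2_lower_bound[OF V E assms(1)]) auto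
        moreover have "(1 - \<epsilon>) * (\<rho> * \<mu> n) \<le> (1 - \<delta>) ^ 3 * (\<rho> * \<mu> n)"
        proof (intro mult_right_mono)
          have "1 + real 3 * (- \<delta>) \<le> (1 + - \<delta>) ^ 3"
            using \<delta> by (intro Bernoulli_inequality) auto
          then show "1 - \<epsilon> \<le> (1 - \<delta>) ^ 3"
            using \<delta> by simp
        qed (use \<rho> \<mu> in auto)
        moreover have "(1 - \<delta>) ^ 3 * (\<rho> * \<mu> n) = (1 - \<delta>) * (\<rho> * D)"
          by (simp add: D_def power2_eq_square power3_eq_cube)
        ultimately show ?thesis
          by simp
      qed
      show ?thesis
        using up low by (simp add: abs_le_iff algebra_simps)
    qed
    moreover have "\<bar>\<rho> * \<mu> n\<bar> = \<rho> * \<mu> n"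
      using \<rho> \<mu> by simp
    ultimately have "measure_pmf.prob (Gnp n (p n)) {E. Good E} \<le> P n"
      unfolding P_def by (intro measure_pmf.finite_measure_mono) (auto simp: \<mu>_def mult.assoc)
    moreover have "measure_pmf.prob (Gnp n (p n)) {E. \<not> Good E} \<le> 2 / real n"
    proof -
      have "measure_pmf.prob (Gnp n (p n)) {E. \<not> Good E} \<le> (real n)\<^sup>2 * (2 * exp (- (\<delta>\<^sup>2 * m / 4)))"
        unfolding Good_def m_def using elim assms(2)[of n] \<delta>
        by (intro Gnp_codegrees_concentrated) auto
      also have "\<dots> \<le> 2 / real n"
        using m \<mu> by (intro small) auto
      finally show ?thesis .
    qed
    moreover have "measure_pmf.prob (Gnp n (p n)) {E. \<not> Good E} = 1 - measure_pmf.prob (Gnp n (p n)) {E. Good E}"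
      using measure_pmf.prob_neg[of "Gnp n (p n)" Good] by simp
    ultimately show ?case
      by simp
  qed
  have "P \<longlonglongrightarrow> 1"
  proof (rule tendsto_sandwich[OF lower])
    show "eventually (\<lambda>n. P n \<le> 1) sequentially"
      by (simp add: P_def)
    show "(\<lambda>n. 1 - 2 / real n) \<longlonglongrightarrow> 1"
      by real_asymp
  qed simp
  then show "(\<lambda>n. measure_pmf.prob (Gnp n (p n)) {E. \<bar>real (kappa r 2 {..<n} E) -
      (1 - 1 / real r) * real n * (p n)\<^sup>2\<bar> \<le> \<epsilon> * \<bar>(1 - 1 / real r) * real n * (p n)\<^sup>2\<bar>}) \<longlonglongrightarrow> 1"
    by (simp add: P_def[abs_def] \<rho>_def)
qed

end
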